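(* Let $a>0$ and $k\in\mathbb{R}$, $k\neq 2$, and let $L_k:\mathbb{C}[x]\to\mathbb{C}$ be the linear functional determined by $$L_k[D_{n,k}D_{m,k}]=h_n(k)\,\delta_{n,m},\quad n,m\in\mathbb{N}_0,\qquad h_0(k)=2-k,\quad h_n(k)=a^n\ (n\ge 1).$$ Then for every $r\in\mathbb{C}[x]$, $$L_k[r]=L_k^{(c)}[r]+\chi(k)\,L_k^{(d)}[r],$$ where $$L_k^{(c)}[r]=\frac{1}{2\pi}\int_{-2\sqrt a}^{2\sqrt a}\frac{r(t)\sqrt{4a-t^2}}{(k-1)t^2+(k-2)^2a}\,dt,\qquad L_k^{(d)}[r]=k\,\frac{r(\Omega)+r(-\Omega)}{2(k-1)(2-k)},$$ with $\Omega=\Omega(k)=\sqrt a\,\dfrac{k-2}{\sqrt{k-1}}\,\mathrm{i}$ for $k\neq1$, and $\chi(k)=0$ if $k\in[0,2]$, $\chi(k)=1$ if $k\in\mathbb{R}\setminus[0,2]$. For $k=1$ the term $\chi(k)L_k^{(d)}[r]$ is understood to be $0$.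
   Context: $\mathbb{N}=\{1,2,\dots\}$, $\mathbb{N}_0=\mathbb{N}\cup\{0\}$, $\delta_{n,m}$ is Kronecker's delta, $\mathrm{i}^2=-1$, and $\sqrt{\cdot}$ is the principal branch of the square root (argument in $(-\pi/2,\pi/2]$). For $a>0$, $k\in\mathbb{R}$, the Dickson polynomials of the $(k+1)$-th kind $D_{n,k}(x)=D_{n,k}(x;a)$ are defined by $D_{0,k}(x;a)=2-k$ and, for $n\ge1$, $$D_{n,k}(x;a)=\sum_{j=0}^{\lfloor n/2\rfloor}\frac{n-kj}{n-j}\binom{n-j}{j}(-a)^jx^{n-2j};$$ equivalently $D_{0,k}=2-k$, $D_{1,k}=x$, $D_{n+2,k}=xD_{n+1,k}-aD_{n,k}$ for $n\in\mathbb{N}_0$. For $k\ne2$, $\deg D_{n,k}=n$ for all $n$ and the stated orthogonality relations determine a unique linear functional $L_k$. *)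

theory Defs
  imports "HOL-Analysis.Analysis" "HOL-Computational_Algebra.Polynomial"
begin

text \<open>
  Dickson polynomials \<open>D\<^sub>n\<^sub>,\<^sub>k(x; a)\<close> of the \<open>(k + 1)\<close>-th kind for a real parameter \<open>k\<close>.
  In every summand \<open>j \<le> n div 2\<close>, so the subtractions \<open>n - j\<close> and \<open>n - 2 * j\<close> on
  \<^typ>\<open>nat\<close> do not truncate, and \<open>n - j > 0\<close> whenever \<open>n > 0\<close>.
\<close>

definition dickson :: "real \<Rightarrow> real \<Rightarrow> nat \<Rightarrow> complex poly" where
  "dickson a k n =
     (if n = 0 then [:complex_of_real (2 - k):]
      else \<Sum>j\<le>n div 2.
             monom (complex_of_real
                      ((real n - k * real j) / real (n - j) * real ((n - j) choose j) * (- a) ^ j))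
                   (n - 2 * j))"

definition dickson_norm :: "real \<Rightarrow> real \<Rightarrow> nat \<Rightarrow> real" where
  "dickson_norm a k n = (if n = 0 then 2 - k else a ^ n)"

definition is_dickson_functional :: "real \<Rightarrow> real \<Rightarrow> (complex poly \<Rightarrow> complex) \<Rightarrow> bool" where
  "is_dickson_functional a k L \<longleftrightarrow>
     Vector_Spaces.linear smult (*) L \<and>
     (\<forall>n m. L (dickson a k n * dickson a k m) =
              (if n = m then complex_of_real (dickson_norm a k n) else 0))"

text \<open>
  For \<open>a > 0\<close> and \<open>k \<noteq> 0\<close> the denominator is positive on the whole interval of integration;
  for \<open>k = 0\<close> it is \<open>4 * a - t\<^sup>2\<close> and vanishes only at the two endpoints, where the
  integrand evaluates to 0 without affecting the (then improper) integral.
\<close>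

definition functional_cont :: "real \<Rightarrow> real \<Rightarrow> complex poly \<Rightarrow> complex" where
  "functional_cont a k r =
     1 / (2 * complex_of_real pi) *
     integral {- 2 * sqrt a .. 2 * sqrt a}
       (\<lambda>t. poly r (complex_of_real t) * complex_of_real (sqrt (4 * a - t\<^sup>2)) /
            complex_of_real ((k - 1) * t\<^sup>2 + (k - 2)\<^sup>2 * a))"

text \<open>
  The root of \<open>k - 1\<close> is complex because \<open>k < 1\<close> is allowed; \<^const>\<open>csqrt\<close> is the
  principal branch.
\<close>

definition Omega :: "real \<Rightarrow> real \<Rightarrow> complex" where
  "Omega a k = complex_of_real (sqrt a) * (complex_of_real (k - 2) / csqrt (complex_of_real (k - 1))) * \<i>"

definition functional_disc :: "real \<Rightarrow> real \<Rightarrow> complex poly \<Rightarrow> complex" where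
  "functional_disc a k r =
     complex_of_real k * (poly r (Omega a k) + poly r (- Omega a k)) /
     complex_of_real (2 * (k - 1) * (2 - k))"

text \<open>
  Since \<open>chi 1 = 0\<close>, the product \<open>chi k * functional_disc a k r\<close> is 0 at \<open>k = 1\<close>, where
  \<^const>\<open>Omega\<close> and \<^const>\<open>functional_disc\<close> have no mathematical meaning.
\<close>

definition chi :: "real \<Rightarrow> complex" where
  "chi k = (if k \<in> {0..2} then 0 else 1)"

end

theory Submission
  imports Defs
begin

text \<open>
  As \<open>D\<^sub>0\<close> is a nonzero constant, orthogonality forces \<open>L D\<^sub>n = \<delta>\<^sub>n\<^sub>,\<^sub>0\<close>, and this
  determines \<open>L\<close> because the \<open>D\<^sub>n\<close> span all polynomials. So it suffices to evaluate the right-hand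
  side at \<open>D\<^sub>n\<close>. With \<open>t = 2 \<surd>a cos \<theta>\<close>, \<open>c = k - 1\<close> and \<open>z = exp (i \<theta>)\<close> the denominator of the
  weight is \<open>a |1 + c z\<^sup>2|\<^sup>2\<close>, and the continuous part becomes \<open>2 / \<pi> a\<^bsup>n/2\<^esup>\<close> times the moment
  \<open>K\<^sub>p = \<integral> sin \<theta> Im (z\<^sup>p / (1 + c z\<^sup>2)) d\<theta>\<close> at \<open>p = n + 1\<close>. The moments, indexed by all integers \<open>p\<close>, are bounded
  and satisfy \<open>K\<^sub>p + c K\<^sub>p\<^sub>+\<^sub>2 = \<plusminus>\<pi>/2\<close> for \<open>p = \<plusminus>1\<close> and \<open>= 0\<close> otherwise; boundedness kills all
  \<open>K\<^sub>p\<close> with \<open>p \<ge> 2\<close> if \<open>|c| < 1\<close>, and all \<open>K\<^sub>p\<close> with \<open>p \<le> 0\<close> if \<open>|c| > 1\<close>, so the recurrence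
  gives the rest. In the second case the point masses compensate exactly, because
  \<open>D\<^sub>n (\<plusminus>\<Omega>) = (2 - k) (\<plusminus>v)\<^sup>n\<close> with \<open>v\<^sup>2 = - a / c\<close>. For \<open>k = 0\<close> the weight in \<open>\<theta>\<close> is constant.
\<close>

subsection \<open>Recurrence and determinacy\<close>

lemma smult_sum_right: "smult c (\<Sum>i\<in>S. f i) = (\<Sum>i\<in>S. smult c (f i))"
  by (induction S rule: infinite_finite_induct) (simp_all add: smult_add_right)

text \<open>These are the Dickson polynomials of the second kind, \<open>dickson a 1\<close>, i.e.
  rescaled Chebyshev polynomials U. The sum runs to \<open>n\<close>, not \<open>n div 2\<close>:
  the extra binomials vanish, and index shifts need no floor.\<close>

definition cheb :: "real \<Rightarrow> nat \<Rightarrow> complex poly" where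
  "cheb a n = (\<Sum>j\<le>n. monom (complex_of_real (real ((n - j) choose j) * (- a) ^ j)) (n - 2 * j))"

text \<open>Pascal's rule, coefficient by coefficient: C(n+1-j, j+1) = C(n-j, j+1) + C(n-j,
  j).\<close>

lemma cheb_rec: "cheb a (Suc (Suc n)) = [:0, 1:] * cheb a (Suc n) - smult (complex_of_real a) (cheb a n)"
proof -
  let ?t = "\<lambda>m j. monom (complex_of_real (real ((m - j) choose j) * (- a) ^ j)) (m - 2 * j)"
  have z: "?t m j = 0" if "m < 2 * j" for m j
    using that by (simp add: binomial_eq_0)
  have x: "[:0, 1:] * ?t (Suc n) j
      = monom (complex_of_real (real ((Suc n - j) choose j) * (- a) ^ j)) (Suc (Suc n) - 2 * j)" for j
  proof (cases "2 * j \<le> Suc n")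
    case True
    then have "Suc (Suc n) - 2 * j = Suc (Suc n - 2 * j)" by simp
    then show ?thesis by (simp add: monom_Suc)
  next
    \<comment> \<open>Truncated subtraction makes the two exponents disagree here, but the common
      coefficient is 0.\<close>
    case False
    then have "(Suc n - j) choose j = 0" by (intro binomial_eq_0) simp
    then show ?thesis by (simp only: of_nat_0 mult_zero_left of_real_0 monom_eq_0 mult_zero_right)
  qed
  have step: "?t (Suc (Suc n)) (Suc j) = [:0, 1:] * ?t (Suc n) (Suc j) - smult (complex_of_real a) (?t n j)"
    if "j \<le> n" for j
  proof -
    have "Suc (Suc n) - Suc j = Suc (n - j)" using that by simp
    then show ?thesis
      unfolding x by (simp add: smult_monom add_monom diff_monom minus_monom algebra_simps)
  qed
  have "cheb a (Suc (Suc n)) = ?t (Suc (Suc n)) 0 + (\<Sum>j\<le>Suc n. ?t (Suc (Suc n)) (Suc j))"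
    unfolding cheb_def by (subst sum.atMost_Suc_shift) simp
  also have "(\<Sum>j\<le>Suc n. ?t (Suc (Suc n)) (Suc j)) = (\<Sum>j\<le>n. ?t (Suc (Suc n)) (Suc j))"
    using z[of "Suc (Suc n)" "Suc (Suc n)"] by (simp add: sum.atMost_Suc)
  also have "\<dots> = (\<Sum>j\<le>n. [:0, 1:] * ?t (Suc n) (Suc j)) - smult (complex_of_real a) (cheb a n)"
    unfolding cheb_def smult_sum_right sum_subtractf[symmetric]
    by (intro sum.cong refl step) simp
  also have "?t (Suc (Suc n)) 0 = [:0, 1:] * ?t (Suc n) 0"
    unfolding x by simp
  also have "[:0, 1:] * ?t (Suc n) 0 + ((\<Sum>j\<le>n. [:0, 1:] * ?t (Suc n) (Suc j))
      - smult (complex_of_real a) (cheb a n))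
      = [:0, 1:] * (?t (Suc n) 0 + (\<Sum>j\<le>n. ?t (Suc n) (Suc j))) - smult (complex_of_real a) (cheb a n)"
    by (simp add: sum_distrib_left distrib_left)
  also have "?t (Suc n) 0 + (\<Sum>j\<le>n. ?t (Suc n) (Suc j)) = cheb a (Suc n)"
    unfolding cheb_def by (subst sum.atMost_Suc_shift) simp
  finally show ?thesis .
qed

lemma dickson_0: "dickson a k 0 = [:complex_of_real (2 - k):]"
  by (simp add: dickson_def)

lemma dickson_1: "dickson a k (Suc 0) = [:0, 1:]"
  by (simp add: dickson_def monom_Suc monom_0)

text \<open>With N = n + 2, write (N - kj)/(N-j) = 1 - (k-1) j/(N-j) and use j/(N-j) C(N-j, j) =
  C(N-j-1, j-1). The correction is then the sum for \<open>cheb a n\<close> shifted by one index, so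
  the recurrence passes from \<open>cheb\<close> to \<open>dickson\<close>.\<close>

lemma dickson_cheb:
  "dickson a k (Suc (Suc n)) = cheb a (Suc (Suc n)) + smult (complex_of_real ((k - 1) * a)) (cheb a n)"
proof -
  let ?N = "Suc (Suc n)"
  let ?t = "\<lambda>m j. monom (complex_of_real (real ((m - j) choose j) * (- a) ^ j)) (m - 2 * j)"
  let ?d = "\<lambda>j. monom (complex_of_real
     ((real ?N - k * real j) / real (?N - j) * real ((?N - j) choose j) * (- a) ^ j)) (?N - 2 * j)"
  have "dickson a k ?N = (\<Sum>j\<le>?N div 2. ?d j)"
    by (simp add: dickson_def)
  also have "\<dots> = (\<Sum>j\<le>Suc n. ?d j)"
    by (rule sum.mono_neutral_left) (auto simp: binomial_eq_0)
  also have "\<dots> = ?d 0 + (\<Sum>j\<le>n. ?d (Suc j))"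
    by (subst sum.atMost_Suc_shift) simp
  also have "?d 0 = ?t ?N 0" by simp
  also have "(\<Sum>j\<le>n. ?d (Suc j)) = (\<Sum>j\<le>n. ?t ?N (Suc j) + smult (complex_of_real ((k - 1) * a)) (?t n j))"
  proof (intro sum.cong refl)
    fix j assume "j \<in> {..n}"
    then have j: "j \<le> n" by simp
    have e: "?N - Suc j = Suc (n - j)" using j by simp
    have b: "real (Suc j) * real (Suc (n - j) choose Suc j) = real (Suc (n - j)) * real ((n - j) choose j)"
      using Suc_times_binomial_eq[of "n - j" j] unfolding of_nat_mult[symmetric] by (simp add: ac_simps)
    have r: "real ?N - k * real (Suc j) = real (Suc (n - j)) - (k - 1) * real (Suc j)"
      using j by (simp add: of_nat_diff algebra_simps)
    have "(real ?N - k * real (Suc j)) / real (Suc (n - j)) * real (Suc (n - j) choose Suc j)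
        = real (Suc (n - j) choose Suc j)
          - (k - 1) * (real (Suc j) * real (Suc (n - j) choose Suc j)) / real (Suc (n - j))"
      unfolding r by (simp add: field_simps del: of_nat_Suc binomial_Suc_Suc)
    also have "\<dots> = real (Suc (n - j) choose Suc j) - (k - 1) * real ((n - j) choose j)"
      unfolding b by (simp del: of_nat_Suc binomial_Suc_Suc)
    finally have E: "(real ?N - k * real (Suc j)) / real (Suc (n - j)) * real (Suc (n - j) choose Suc j)
        = real (Suc (n - j) choose Suc j) - (k - 1) * real ((n - j) choose j)" .
    have "(real ?N - k * real (Suc j)) / real (Suc (n - j)) * real (Suc (n - j) choose Suc j)
         * (- a) ^ Suc j = real (Suc (n - j) choose Suc j) * (- a) ^ Suc j
             + (k - 1) * a * (real ((n - j) choose j) * (- a) ^ j)"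
      unfolding E by (simp add: algebra_simps del: of_nat_Suc binomial_Suc_Suc)
    then show "?d (Suc j) = ?t ?N (Suc j) + smult (complex_of_real ((k - 1) * a)) (?t n j)"
      unfolding e smult_monom of_real_mult[symmetric]
      by (simp add: add_monom del: of_nat_Suc binomial_Suc_Suc of_real_mult flip: of_real_add)
  qed
  also have "\<dots> = (\<Sum>j\<le>n. ?t ?N (Suc j)) + smult (complex_of_real ((k - 1) * a)) (cheb a n)"
    unfolding cheb_def smult_sum_right by (rule sum.distrib)
  also have "?t ?N 0 + ((\<Sum>j\<le>n. ?t ?N (Suc j)) + smult (complex_of_real ((k - 1) * a)) (cheb a n))
     = (?t ?N 0 + (\<Sum>j\<le>Suc n. ?t ?N (Suc j))) + smult (complex_of_real ((k - 1) * a)) (cheb a n)"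
    by simp
  also have "?t ?N 0 + (\<Sum>j\<le>Suc n. ?t ?N (Suc j)) = cheb a ?N"
    unfolding cheb_def by (subst sum.atMost_Suc_shift) simp
  finally show ?thesis .
qed

lemma dickson_rec:
  "dickson a k (Suc (Suc n)) = [:0, 1:] * dickson a k (Suc n) - smult (complex_of_real a) (dickson a k n)"
proof -
  have c0: "cheb a 0 = 1" and c1: "cheb a (Suc 0) = [:0, 1:]"
    by (simp_all add: cheb_def monom_Suc monom_0 flip: one_pCons)
  \<comment> \<open>The splitting into \<open>cheb\<close> starts at index 2, so n = 0 and n = 1 are
    separate; at n = 0 the convention D_0 = 2 - k is exactly what the recurrence demands.\<close>
  consider "n = 0" | "n = Suc 0" | m where "n = Suc (Suc m)"
    by (metis not0_implies_Suc)
  then show ?thesis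
  proof cases
    case 1
    then show ?thesis
      by (simp add: dickson_cheb cheb_rec dickson_0 dickson_1 c0 c1 algebra_simps)
  next
    case 2
    then show ?thesis
      by (simp add: dickson_cheb cheb_rec dickson_1 c0 c1 algebra_simps)
  next
    case 3
    show ?thesis
      unfolding 3 dickson_cheb
      by (subst (1 2) cheb_rec) (simp add: smult_add_right smult_diff_right algebra_simps)
  qed
qed

section \<open>Determinacy of a functional by its values on the Dickson polynomials\<close>

lemma linear_functional_eq_0:
  fixes M :: "complex poly \<Rightarrow> complex"
  assumes add: "\<And>p q. M (p + q) = M p + M q" and scale: "\<And>c p. M (smult c p) = c * M p"
    and k: "k \<noteq> 2" and D: "\<And>n. M (dickson a k n) = 0"
  shows "M r = 0"
proof -
  \<comment> \<open>The claim is strengthened to products: a factor x of r can be moved onto D_n,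
    where the recurrence turns it into neighbouring D_m. At the end D_0, a nonzero constant, is
    divided out.\<close>
  have "M (r * dickson a k n) = 0" for n
  proof (induction r arbitrary: n rule: pCons_induct)
    case 0
    then show ?case using scale[of 0 0] by simp
  next
    case (pCons c p)
    have X: "pCons c p * dickson a k n = smult c (dickson a k n) + p * ([:0, 1:] * dickson a k n)"
      by simp
    have "M (p * ([:0, 1:] * dickson a k n)) = 0"
    proof (cases n)
      case 0
      have "p * ([:0, 1:] * dickson a k n) = smult (complex_of_real (2 - k)) (p * dickson a k (Suc 0))"
        unfolding 0 by (simp add: dickson_0 dickson_1)
      then show ?thesis by (simp only: scale pCons.IH mult_zero_right)
    next
      case (Suc m)
      have "p * ([:0, 1:] * dickson a k n)
          = p * dickson a k (Suc (Suc m)) + smult (complex_of_real a) (p * dickson a k m)"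
        unfolding Suc dickson_rec[of a k m] by (simp add: algebra_simps)
      then show ?thesis by (simp only: add scale pCons.IH mult_zero_right add_0)
    qed
    then show ?case unfolding X by (simp add: add scale D)
  qed
  from this[of 0] have "(2 - complex_of_real k) * M r = 0"
    by (simp add: dickson_0 scale)
  moreover have "2 - complex_of_real k \<noteq> 0"
    using k by (metis eq_iff_diff_eq_0 of_real_eq_iff of_real_numeral)
  ultimately show ?thesis by simp
qed

subsection \<open>The substitution \<open>t = 2 \<surd>a cos \<theta>\<close>\<close>

text \<open>The primitive -G(arccos(t/s)) is continuous on the closed interval but differentiable
  only inside, so the interior form of the fundamental theorem is used. It leaves \<open>f\<close>
  free at the endpoints, allows it to be unbounded there, and yields integrability as well.\<close>

lemma has_integral_arccos_substitution:
  fixes g :: "real \<Rightarrow> complex"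
  assumes g: "continuous_on {0..pi} g" and s: "s > 0"
    and f: "\<And>t. - s < t \<Longrightarrow> t < s \<Longrightarrow> f t = g (arccos (t / s)) / complex_of_real (sqrt (s\<^sup>2 - t\<^sup>2))"
  shows "(f has_integral integral {0..pi} g) {- s..s}"
proof -
  define G where "G \<theta> = integral {0..\<theta>} g" for \<theta>
  define F where "F t = - G (arccos (t / s))" for t
  have contG: "continuous_on {0..pi} G"
    unfolding G_def using g by (intro indefinite_integral_continuous_1 integrable_continuous_interval)
  have contF: "continuous_on {- s..s} F"
    unfolding F_def using s
    by (intro continuous_intros continuous_on_compose2[OF contG])
       (auto simp: arccos_lbound arccos_ubound field_simps)
  have der: "(F has_vector_derivative f t) (at t)" if t: "t \<in> {- s<..<s}" for t
  proof -
    let ?u = "t / s"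
    have u: "-1 < ?u" "?u < 1" using t s by (auto simp: field_simps)
    have th: "0 < arccos ?u" "arccos ?u < pi" using arccos_lt_bounded[OF u] by auto
    have G': "(G has_vector_derivative g (arccos ?u)) (at (arccos ?u))"
    proof -
      have "(G has_vector_derivative g (arccos ?u)) (at (arccos ?u) within {0..pi})"
        unfolding G_def using th by (intro integral_has_vector_derivative g) auto
      then show ?thesis using th by (simp add: at_within_Icc_at)
    qed
    have "((\<lambda>t. arccos (t / s)) has_real_derivative inverse (- sqrt (1 - ?u\<^sup>2)) * (1 / s)) (at t)"
      by (rule DERIV_chain2[where f = arccos and g = "\<lambda>t. t / s",
            OF DERIV_arccos[OF u] DERIV_cdivide[OF DERIV_ident]])
    then have A: "((\<lambda>t. arccos (t / s)) has_vector_derivative inverse (- sqrt (1 - ?u\<^sup>2)) * (1 / s)) (at t)"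
      by (simp add: has_real_derivative_iff_has_vector_derivative)
    have "((G \<circ> (\<lambda>t. arccos (t / s))) has_vector_derivative
        (inverse (- sqrt (1 - ?u\<^sup>2)) * (1 / s)) *\<^sub>R g (arccos ?u)) (at t)"
      by (rule vector_diff_chain_at[OF A G'])
    then have "(F has_vector_derivative - ((inverse (- sqrt (1 - ?u\<^sup>2)) * (1 / s)) *\<^sub>R g (arccos ?u))) (at t)"
      unfolding F_def[abs_def] by (intro has_vector_derivative_minus) (simp add: o_def)
    moreover have "s * sqrt (1 - ?u\<^sup>2) = sqrt (s\<^sup>2 - t\<^sup>2)"
    proof -
      have "sqrt (s\<^sup>2 - t\<^sup>2) = sqrt (s\<^sup>2 * (1 - ?u\<^sup>2))"
        using s by (simp add: power_divide field_simps)
      then show ?thesis using s by (simp add: real_sqrt_mult)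
    qed
    then have "- (inverse (- sqrt (1 - ?u\<^sup>2)) * (1 / s)) = 1 / sqrt (s\<^sup>2 - t\<^sup>2)"
      by (metis inverse_eq_divide inverse_minus_eq inverse_mult_distrib minus_minus mult.commute mult_minus_left)
    then have "- ((inverse (- sqrt (1 - ?u\<^sup>2)) * (1 / s)) *\<^sub>R g (arccos ?u)) = f t"
      unfolding scaleR_minus_left[symmetric] using f[of t] t by (simp add: scaleR_conv_of_real)
    ultimately show ?thesis by simp
  qed
  have "(f has_integral F s - F (- s)) {- s..s}"
    using s contF der by (intro fundamental_theorem_of_calculus_interior) auto
  moreover have "F s - F (- s) = integral {0..pi} g"
    using s by (simp add: F_def G_def)
  ultimately show ?thesis by simp
qed

text \<open>\<open>den k \<theta> = |1 + (k - 1) exp (2 i \<theta>)|\<^sup>2\<close>, written so that its positivity is visible.\<close>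
definition den :: "real \<Rightarrow> real \<Rightarrow> real" where
  "den k \<theta> = k\<^sup>2 * (cos \<theta>)\<^sup>2 + (2 - k)\<^sup>2 * (sin \<theta>)\<^sup>2"

text \<open>For k = 0 the quotient is 1 except at 0 and pi, where it would read 0/0; the case split
  supplies the continuous extension.\<close>

definition weight :: "real \<Rightarrow> real \<Rightarrow> real" where
  "weight k \<theta> = (if k = 0 then 1 else 4 * (sin \<theta>)\<^sup>2 / den k \<theta>)"

lemma den_alt: "den k \<theta> = 4 * (k - 1) * (cos \<theta>)\<^sup>2 + (k - 2)\<^sup>2"
  unfolding den_def sin_squared_eq by (simp add: power2_eq_square algebra_simps)

lemma den_lower_bound: "min (k\<^sup>2) ((2 - k)\<^sup>2) \<le> den k \<theta>"
proof -
  let ?m = "min (k\<^sup>2) ((2 - k)\<^sup>2)"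
  have "?m = ?m * (cos \<theta>)\<^sup>2 + ?m * (sin \<theta>)\<^sup>2"
    by (simp flip: distrib_left)
  also have "\<dots> \<le> den k \<theta>"
    unfolding den_def by (intro add_mono mult_right_mono) auto
  finally show ?thesis .
qed

lemma den_pos: "k \<noteq> 0 \<Longrightarrow> k \<noteq> 2 \<Longrightarrow> den k \<theta> > 0"
  using den_lower_bound[of k \<theta>] by (auto simp: min_def split: if_splits intro: less_le_trans[rotated])

lemma continuous_den [continuous_intros]: "continuous_on A (den k)"
  unfolding den_def by (intro continuous_intros)

lemma continuous_weight: "k \<noteq> 2 \<Longrightarrow> continuous_on A (weight k)"
  unfolding weight_def
  by (cases "k = 0") (auto intro!: continuous_intros dest: less_imp_neq[OF den_pos])

text \<open>A division-free form that holds for k = 0 too, so the substitution below needs no case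
  distinction.\<close>

lemma weight_den:
  assumes "k \<noteq> 2"
  shows "weight k \<theta> * den k \<theta> = 4 * (sin \<theta>)\<^sup>2"
  using den_pos[of k \<theta>] assms by (cases "k = 0") (auto simp: weight_def den_def)

lemma continuous_poly_weight:
  assumes "k \<noteq> 2"
  shows "continuous_on {0..pi}
    (\<lambda>\<theta>. poly r (complex_of_real (2 * sqrt a * cos \<theta>)) * complex_of_real (weight k \<theta>))"
  using continuous_weight[OF assms] by (intro continuous_intros) auto

lemma functional_cont_eq:
  assumes "a > 0" "k \<noteq> 2"
  shows "functional_cont a k r = 1 / (2 * complex_of_real pi) * integral {0..pi}
    (\<lambda>\<theta>. poly r (complex_of_real (2 * sqrt a * cos \<theta>)) * complex_of_real (weight k \<theta>))"
proof -
  define s where "s = 2 * sqrt a"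
  have s: "s > 0" "s\<^sup>2 = 4 * a" using assms by (auto simp: s_def power_mult_distrib)
  \<comment> \<open>The integrand is brought to the shape g / sqrt(s^2 - t^2) of the substitution
    rule, using s^2 - t^2 = a * \<open>weight\<close> * \<open>den\<close>.\<close>
  have *: "poly r (complex_of_real t) * complex_of_real (sqrt (4 * a - t\<^sup>2)) /
        complex_of_real ((k - 1) * t\<^sup>2 + (k - 2)\<^sup>2 * a)
      = poly r (complex_of_real (2 * sqrt a * cos (arccos (t / s)))) * complex_of_real (weight k (arccos (t / s)))
        / complex_of_real (sqrt (s\<^sup>2 - t\<^sup>2))" if t: "- s < t" "t < s" for t
  proof -
    define \<theta> where "\<theta> = arccos (t / s)"
    have u: "-1 < t / s" "t / s < 1" using t s by (auto simp: field_simps)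
    have c: "cos \<theta> = t / s" using u unfolding \<theta>_def by (intro cos_arccos) auto
    have st: "2 * sqrt a * cos \<theta> = t" using s unfolding c by (simp add: s_def)
    have th: "0 < \<theta>" "\<theta> < pi" using arccos_lt_bounded[OF u] unfolding \<theta>_def by auto
    have sin: "sin \<theta> > 0" by (rule sin_gt_zero[OF th])
    have d: "(k - 1) * t\<^sup>2 + (k - 2)\<^sup>2 * a = a * den k \<theta>"
      unfolding den_alt st[symmetric] using assms by (simp add: power_mult_distrib algebra_simps)
    have w: "s\<^sup>2 - t\<^sup>2 = 4 * a * (sin \<theta>)\<^sup>2"
      unfolding st[symmetric] sin_squared_eq s(2) using assms by (simp add: power_mult_distrib algebra_simps)
    have wd: "s\<^sup>2 - t\<^sup>2 = a * (weight k \<theta> * den k \<theta>)"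
      unfolding w weight_den[OF assms(2)] by simp
    have pos: "s\<^sup>2 - t\<^sup>2 > 0" unfolding w using sin assms by simp
    \<comment> \<open>For k = 0 \<open>den\<close> vanishes at the endpoints; in the interior its
      being nonzero is read off from s^2 - t^2 > 0.\<close>
    then have dn: "a * den k \<theta> \<noteq> 0" unfolding wd by auto
    have "sqrt (s\<^sup>2 - t\<^sup>2) * sqrt (s\<^sup>2 - t\<^sup>2) = weight k \<theta> * (a * den k \<theta>)"
      using pos wd by simp
    then have "sqrt (s\<^sup>2 - t\<^sup>2) / (a * den k \<theta>) = weight k \<theta> / sqrt (s\<^sup>2 - t\<^sup>2)"
      using dn pos by (subst frac_eq_eq) auto
    then have "complex_of_real (sqrt (s\<^sup>2 - t\<^sup>2)) / complex_of_real (a * den k \<theta>)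
        = complex_of_real (weight k \<theta>) / complex_of_real (sqrt (s\<^sup>2 - t\<^sup>2))"
      by (metis of_real_divide)
    then show ?thesis
      unfolding \<theta>_def[symmetric] st d s(2)[symmetric] times_divide_eq_right[symmetric] by simp
  qed
  have "- 2 * sqrt a = - s" "2 * sqrt a = s" by (simp_all add: s_def)
  then show ?thesis
    unfolding functional_cont_def
    using has_integral_arccos_substitution[OF continuous_poly_weight[OF assms(2)] s(1) *]
    by (simp add: integral_unique)
qed

text \<open>Additivity needs integrability, which is immediate only after the substitution, where
  the integrand is continuous.\<close>

lemma functional_cont_add:
  assumes "a > 0" "k \<noteq> 2"
  shows "functional_cont a k (p + q) = functional_cont a k p + functional_cont a k q"
proof -
  note i = integrable_continuous_interval[OF continuous_poly_weight[OF assms(2)]]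
  show ?thesis
    unfolding functional_cont_eq[OF assms] poly_add distrib_right
    by (simp only: integral_add[OF i i] distrib_left)
qed

lemma functional_cont_smult:
  "functional_cont a k (smult c p) = c * functional_cont a k p"
  unfolding functional_cont_def by (simp add: mult.assoc flip: times_divide_eq_right)

section \<open>Closed forms of the Dickson polynomials at 2 sqrt(a) cos(theta)\<close>

text \<open>Both sides obey the same recurrence, by sin(y + theta) = 2 cos(theta) sin(y) - sin(y -
  theta). The factor sin(theta) avoids a division at the endpoints and is later taken from the
  weight.\<close>

lemma dickson_cos:
  assumes "a > 0"
  shows "complex_of_real (sin \<theta>) * poly (dickson a k n) (complex_of_real (2 * sqrt a * cos \<theta>))
    = complex_of_real (sqrt a ^ n * (sin ((real n + 1) * \<theta>) + (k - 1) * sin ((real n - 1) * \<theta>)))"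
proof (induction n rule: induct_nat_012)
  case 0
  then show ?case by (simp add: dickson_0 algebra_simps)
next
  case 1
  then show ?case by (simp add: dickson_1 sin_double)
next
  case (ge2 n)
  have t: "sin (y + \<theta>) = 2 * cos \<theta> * sin y - sin (y - \<theta>)" for y :: real
    by (simp add: sin_add sin_diff)
  have e: "(real (Suc (Suc n)) + 1) * \<theta> = (real (Suc n) + 1) * \<theta> + \<theta>"
      "(real (Suc (Suc n)) - 1) * \<theta> = (real (Suc n) - 1) * \<theta> + \<theta>"
      "(real (Suc n) + 1) * \<theta> - \<theta> = (real n + 1) * \<theta>"
      "(real (Suc n) - 1) * \<theta> - \<theta> = (real n - 1) * \<theta>"
    by (simp_all add: algebra_simps)
  have s: "sqrt a * (sqrt a * x) = a * x" for x using assms by simp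
  let ?x = "complex_of_real (2 * sqrt a * cos \<theta>)" and ?S = "complex_of_real (sin \<theta>)"
  have "?S * poly (dickson a k (Suc (Suc n))) ?x
      = ?x * (?S * poly (dickson a k (Suc n)) ?x) - complex_of_real a * (?S * poly (dickson a k n) ?x)"
    by (simp add: dickson_rec algebra_simps)
  also have "\<dots> = complex_of_real (2 * sqrt a * cos \<theta> *
         (sqrt a ^ Suc n * (sin ((real (Suc n) + 1) * \<theta>) + (k - 1) * sin ((real (Suc n) - 1) * \<theta>)))
       - (sqrt a)\<^sup>2 * (sqrt a ^ n * (sin ((real n + 1) * \<theta>) + (k - 1) * sin ((real n - 1) * \<theta>))))"
    unfolding ge2.IH using assms by simp
  also have "2 * sqrt a * cos \<theta> *
         (sqrt a ^ Suc n * (sin ((real (Suc n) + 1) * \<theta>) + (k - 1) * sin ((real (Suc n) - 1) * \<theta>)))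
       - (sqrt a)\<^sup>2 * (sqrt a ^ n * (sin ((real n + 1) * \<theta>) + (k - 1) * sin ((real n - 1) * \<theta>)))
     = sqrt a ^ Suc (Suc n) * (sin ((real (Suc (Suc n)) + 1) * \<theta>) + (k - 1) * sin ((real (Suc (Suc n)) - 1) * \<theta>))"
    unfolding e(1,2) t e(3,4) using assms by (simp add: s algebra_simps)
  finally show ?case .
qed

text \<open>The first kind, 2 T_n rescaled. For k = 0 the weight is constant and offers no sine
  factor, so \<open>dickson_cos\<close> cannot be applied.\<close>

lemma dickson_zero_cos:
  assumes "a > 0"
  shows "poly (dickson a 0 n) (complex_of_real (2 * sqrt a * cos \<theta>))
    = complex_of_real (2 * sqrt a ^ n * cos (real n * \<theta>))"
proof (induction n rule: induct_nat_012)
  case 0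
  then show ?case by (simp add: dickson_0)
next
  case 1
  then show ?case by (simp add: dickson_1)
next
  case (ge2 n)
  have e: "real (Suc (Suc n)) * \<theta> = real (Suc n) * \<theta> + \<theta>" "real n * \<theta> = real (Suc n) * \<theta> - \<theta>"
    by (simp_all add: algebra_simps)
  have s: "sqrt a * (sqrt a * x) = a * x" for x using assms by simp
  let ?x = "complex_of_real (2 * sqrt a * cos \<theta>)"
  have "poly (dickson a 0 (Suc (Suc n))) ?x
      = ?x * poly (dickson a 0 (Suc n)) ?x - complex_of_real a * poly (dickson a 0 n) ?x"
    by (simp add: dickson_rec)
  also have "\<dots> = complex_of_real (2 * sqrt a * cos \<theta> * (2 * sqrt a ^ Suc n * cos (real (Suc n) * \<theta>))
       - (sqrt a)\<^sup>2 * (2 * sqrt a ^ n * cos (real n * \<theta>)))"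
    unfolding ge2.IH using assms by simp
  also have "2 * sqrt a * cos \<theta> * (2 * sqrt a ^ Suc n * cos (real (Suc n) * \<theta>))
       - (sqrt a)\<^sup>2 * (2 * sqrt a ^ n * cos (real n * \<theta>))
     = 2 * sqrt a ^ Suc (Suc n) * cos (real (Suc (Suc n)) * \<theta>)"
    unfolding e cos_add cos_diff using assms by (simp add: s algebra_simps)
  finally show ?case .
qed

subsection \<open>Trigonometric integrals\<close>

lemma has_integral_cos_int_multiple:
  "((\<lambda>\<theta>. cos (of_int m * \<theta>)) has_integral (if m = 0 then pi else 0)) {0..pi}"
proof (cases "m = 0")
  case True
  then show ?thesis using has_integral_const_real[of "1::real" 0 pi] by simp
next
  case False
  have "((\<lambda>\<theta>. cos (of_int m * \<theta>)) has_integral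
      sin (of_int m * pi) / of_int m - sin (of_int m * 0) / of_int m) {0..pi}"
    using False
    by (intro fundamental_theorem_of_calculus)
       (auto intro!: derivative_eq_intros simp flip: has_real_derivative_iff_has_vector_derivative)
  moreover have "sin (of_int m * pi) = 0"
    by (subst mult.commute) (simp add: sin_integer_2pi sin_zero_iff_int2)
  ultimately show ?thesis using False by simp
qed

lemma has_integral_sin_sin:
  "((\<lambda>\<theta>. sin \<theta> * sin (of_int p * \<theta>)) has_integral
     (if p = 1 then pi / 2 else if p = -1 then - pi / 2 else 0)) {0..pi}"
proof -
  have e: "sin \<theta> * sin (of_int p * \<theta>) = (cos (of_int (p - 1) * \<theta>) - cos (of_int (p + 1) * \<theta>)) / 2" for \<theta> :: real
    by (simp add: cos_diff cos_add algebra_simps)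
  show ?thesis
    unfolding e
    using has_integral_divide[OF has_integral_diff[OF has_integral_cos_int_multiple[of "p - 1"]
          has_integral_cos_int_multiple[of "p + 1"]], of 2]
    by (auto split: if_splits simp: algebra_simps add_eq_0_iff)
qed

text \<open>\<open>sin \<theta> Im (exp (i p \<theta>) / (1 + (k - 1) exp (2 i \<theta>)))\<close>, with the fraction made real.\<close>
definition dickson_kernel :: "real \<Rightarrow> int \<Rightarrow> real \<Rightarrow> real" where
  "dickson_kernel k p \<theta> = sin \<theta> * (sin (of_int p * \<theta>) + (k - 1) * sin (of_int (p - 2) * \<theta>)) / den k \<theta>"

definition dickson_moment :: "real \<Rightarrow> int \<Rightarrow> real" where
  "dickson_moment k p = integral {0..pi} (dickson_kernel k p)"

lemma dickson_kernel_integrable: "k \<noteq> 0 \<Longrightarrow> k \<noteq> 2 \<Longrightarrow> dickson_kernel k p integrable_on {0..pi}"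
  unfolding dickson_kernel_def using den_pos[of k]
  by (intro integrable_continuous_interval continuous_intros) (auto simp: less_imp_neq[symmetric])

text \<open>With c = k - 1, adding z^p / (1 + c z^2) and c z^(p+2) / (1 + c z^2) cancels the
  denominator. What remains is the integral of sin(theta) sin(p theta).\<close>

lemma dickson_moment_rec:
  assumes "k \<noteq> 0" "k \<noteq> 2"
  shows "dickson_moment k p + (k - 1) * dickson_moment k (p + 2)
    = (if p = 1 then pi / 2 else if p = -1 then - pi / 2 else 0)"
proof -
  have pw: "dickson_kernel k p \<theta> + (k - 1) * dickson_kernel k (p + 2) \<theta> = sin \<theta> * sin (of_int p * \<theta>)" for \<theta>
  proof -
    define y where "y = of_int p * \<theta>"
    have e: "of_int (p - 2) * \<theta> = y - 2 * \<theta>" "of_int (p + 2) * \<theta> = y + 2 * \<theta>"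
        "of_int (p + 2 - 2) * \<theta> = y"
      by (simp_all add: y_def algebra_simps)
    have d: "den k \<theta> = 1 + (k - 1)\<^sup>2 + 2 * (k - 1) * cos (2 * \<theta>)"
      unfolding den_alt cos_double_cos by (simp add: power2_eq_square algebra_simps)
    have "(sin y + (k - 1) * sin (y - 2 * \<theta>)) + (k - 1) * (sin (y + 2 * \<theta>) + (k - 1) * sin y)
        = den k \<theta> * sin y"
      unfolding d sin_add sin_diff by (simp add: power2_eq_square algebra_simps)
    then have "(sin \<theta> * ((sin y + (k - 1) * sin (y - 2 * \<theta>)) + (k - 1) * (sin (y + 2 * \<theta>) + (k - 1) * sin y))) / den k \<theta>
        = sin \<theta> * sin y"
      using den_pos[OF assms, of \<theta>] by simp
    then show ?thesis
      unfolding dickson_kernel_def e y_def[symmetric]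
      by (simp only: distrib_left add_divide_distrib times_divide_eq_right mult.left_commute)
  qed
  have "((\<lambda>\<theta>. dickson_kernel k p \<theta> + (k - 1) * dickson_kernel k (p + 2) \<theta>) has_integral
      (dickson_moment k p + (k - 1) * dickson_moment k (p + 2))) {0..pi}"
    unfolding dickson_moment_def
    by (intro has_integral_add has_integral_mult_right integrable_integral dickson_kernel_integrable assms)
  then show ?thesis
    unfolding pw using has_integral_sin_sin by (rule has_integral_unique)
qed

lemma dickson_moment_bounded:
  assumes "k \<noteq> 0" "k \<noteq> 2"
  obtains B where "\<And>p. \<bar>dickson_moment k p\<bar> \<le> B"
proof
  fix p
  let ?m = "min (k\<^sup>2) ((2 - k)\<^sup>2)"
  have m: "?m > 0" using assms by auto
  have "norm (dickson_kernel k p \<theta>) \<le> (1 + \<bar>k - 1\<bar>) / ?m" for \<theta>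
  proof -
    have "\<bar>sin (of_int p * \<theta>) + (k - 1) * sin (of_int (p - 2) * \<theta>)\<bar>
        \<le> \<bar>sin (of_int p * \<theta>)\<bar> + \<bar>k - 1\<bar> * \<bar>sin (of_int (p - 2) * \<theta>)\<bar>"
      by (metis abs_mult abs_triangle_ineq)
    also have "\<dots> \<le> 1 + \<bar>k - 1\<bar> * 1"
      by (intro add_mono mult_left_mono) (auto simp del: of_int_diff)
    finally have "\<bar>sin \<theta>\<bar> * \<bar>sin (of_int p * \<theta>) + (k - 1) * sin (of_int (p - 2) * \<theta>)\<bar> \<le> 1 * (1 + \<bar>k - 1\<bar>)"
      by (intro mult_mono) auto
    then show ?thesis
      unfolding dickson_kernel_def using m den_lower_bound[of k \<theta>]
      by (simp only: real_norm_def abs_mult abs_divide) (intro frac_le, auto)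
  qed
  then have "norm (dickson_moment k p) \<le> integral {0..pi} (\<lambda>_. (1 + \<bar>k - 1\<bar>) / ?m)"
    unfolding dickson_moment_def by (intro integral_norm_bound_integral dickson_kernel_integrable assms) auto
  then show "\<bar>dickson_moment k p\<bar> \<le> integral {0..pi} (\<lambda>_. (1 + \<bar>k - 1\<bar>) / ?m)" by simp
qed

text \<open>Iteration gives f 0 = q^j f j, which tends to 0 because f is bounded.\<close>

lemma bounded_contraction_orbit_0:
  fixes f :: "nat \<Rightarrow> real"
  assumes B: "\<And>j. \<bar>f j\<bar> \<le> B" and q: "\<bar>q\<bar> < 1" and rec: "\<And>j. f j = q * f (Suc j)"
  shows "f 0 = 0"
proof -
  have pow: "f 0 = q ^ j * f j" for j
  proof (induction j)
    case (Suc j)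
    then show ?case using rec[of j] by simp
  qed simp
  have "(\<lambda>j. \<bar>q\<bar> ^ j * B) \<longlonglongrightarrow> 0 * B"
    using q by (intro tendsto_mult_right LIMSEQ_power_zero) auto
  moreover have "\<bar>f 0\<bar> \<le> \<bar>q\<bar> ^ j * B" for j
    using B[of j] by (subst pow[of j]) (simp add: abs_mult power_abs mult_left_mono)
  ultimately have "\<bar>f 0\<bar> \<le> 0" by (intro LIMSEQ_le_const[where x = "0 :: real"]) auto
  then show ?thesis by simp
qed

lemma dickson_moment_inner:
  assumes "0 < k" "k < 2" "p \<ge> 1"
  shows "dickson_moment k p = (if p = 1 then pi / 2 else 0)"
proof -
  have k: "k \<noteq> 0" "k \<noteq> 2" using assms by auto
  obtain B where B: "\<And>p. \<bar>dickson_moment k p\<bar> \<le> B" using dickson_moment_bounded[OF k] by blast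
  have z: "dickson_moment k q = 0" if "q \<ge> 2" for q
  proof -
    \<comment> \<open>Upwards from q >= 2 the recurrence is homogeneous, with ratio 1 - k of modulus
      below 1.\<close>
    have "dickson_moment k (q + 2 * int j) = - (k - 1) * dickson_moment k (q + 2 * int (Suc j))" for j
      using dickson_moment_rec[OF k, of "q + 2 * int j"] that by (simp add: algebra_simps split: if_splits)
    from bounded_contraction_orbit_0[of "\<lambda>j. dickson_moment k (q + 2 * int j)" B "- (k - 1)", OF B _ this] show ?thesis using assms by simp
  qed
  show ?thesis
    using dickson_moment_rec[OF k, of 1] z[of 3] z[of p] assms(3) by (cases "p = 1") auto
qed

lemma dickson_moment_outer:
  assumes "k < 0 \<or> 2 < k"
  shows "dickson_moment k 1 = - pi / (2 * (k - 1))"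
    and "dickson_moment k 2 = 0"
    and "dickson_moment k 3 = pi * k / (2 * (k - 1)\<^sup>2)"
    and "p \<ge> 2 \<Longrightarrow> dickson_moment k (p + 2) = - dickson_moment k p / (k - 1)"
proof -
  have k: "k \<noteq> 0" "k \<noteq> 2" "k - 1 \<noteq> 0" using assms by auto
  obtain B where B: "\<And>p. \<bar>dickson_moment k p\<bar> \<le> B" using dickson_moment_bounded[OF k(1,2)] by blast
  have z: "dickson_moment k q = 0" if "q \<le> 0" for q
  proof -
    \<comment> \<open>Now the contraction runs downwards. For q <= 0 the recurrence is used at
      indices at most -2, which avoids the inhomogeneous terms at p = -1 and p = 1.\<close>
    have st: "dickson_moment k (q - 2 * int j) = - (1 / (k - 1)) * dickson_moment k (q - 2 * int (Suc j))" for j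
      using dickson_moment_rec[OF k(1,2), of "q - 2 * int (Suc j)"] that k(3)
      by (simp add: field_simps split: if_splits)
    have "\<bar>- (1 / (k - 1))\<bar> < 1" using assms by (auto simp: field_simps abs_if)
    from bounded_contraction_orbit_0[of "\<lambda>j. dickson_moment k (q - 2 * int j)" B, OF B this st]
    show ?thesis by simp
  qed
  \<comment> \<open>The vanishing moments K_(-1) and K_0 start the upward recursion: p = -1, 0, 1
    give K_1, K_2, K_3.\<close>
  show 1: "dickson_moment k 1 = - pi / (2 * (k - 1))"
    using dickson_moment_rec[OF k(1,2), of "-1"] z[of "-1"] k(3) by (simp add: field_simps)
  show "dickson_moment k 2 = 0"
    using dickson_moment_rec[OF k(1,2), of 0] z[of 0] k(3) by simp
  have "(k - 1) * dickson_moment k 3 = pi / 2 + pi / (2 * (k - 1))"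
    using dickson_moment_rec[OF k(1,2), of 1] 1 by simp
  also have "\<dots> = (k - 1) * (pi * k / (2 * (k - 1)\<^sup>2))"
    using k(3) by (simp add: power2_eq_square divide_simps) (simp add: algebra_simps)
  finally show "dickson_moment k 3 = pi * k / (2 * (k - 1)\<^sup>2)"
    unfolding mult_left_cancel[OF k(3)] .
  show "dickson_moment k (p + 2) = - dickson_moment k p / (k - 1)" if "p \<ge> 2"
    using dickson_moment_rec[OF k(1,2), of p] that k(3) by (simp add: field_simps add_eq_0_iff)
qed

subsection \<open>Values of both functionals on the Dickson polynomials\<close>

text \<open>One of the two sines in the weight turns the polynomial into the closed form of
  \<open>dickson_cos\<close>; the other stays in the kernel.\<close>

lemma functional_cont_dickson:
  assumes "a > 0" "k \<noteq> 0" "k \<noteq> 2"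
  shows "functional_cont a k (dickson a k n)
    = complex_of_real (2 / pi * sqrt a ^ n * dickson_moment k (int n + 1))"
proof -
  have pw: "poly (dickson a k n) (complex_of_real (2 * sqrt a * cos \<theta>)) * complex_of_real (weight k \<theta>)
      = complex_of_real (4 * sqrt a ^ n * dickson_kernel k (int n + 1) \<theta>)" for \<theta>
  proof -
    have "poly (dickson a k n) (complex_of_real (2 * sqrt a * cos \<theta>)) * complex_of_real (weight k \<theta>)
      = (complex_of_real (sin \<theta>) * poly (dickson a k n) (complex_of_real (2 * sqrt a * cos \<theta>)))
         * complex_of_real (4 * sin \<theta> / den k \<theta>)"
      using assms by (simp add: weight_def power2_eq_square)
    also have "\<dots> = complex_of_real (4 * sqrt a ^ n * dickson_kernel k (int n + 1) \<theta>)"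
      unfolding dickson_cos[OF assms(1)] of_real_mult[symmetric] of_real_eq_iff
      by (simp add: dickson_kernel_def ac_simps)
    finally show ?thesis .
  qed
  have I: "((\<lambda>\<theta>. complex_of_real (4 * sqrt a ^ n * dickson_kernel k (int n + 1) \<theta>)) has_integral
      complex_of_real (4 * sqrt a ^ n * dickson_moment k (int n + 1))) {0..pi}"
    unfolding dickson_moment_def
    by (intro has_integral_of_real has_integral_mult_right integrable_integral dickson_kernel_integrable assms)
  show ?thesis
    unfolding functional_cont_eq[OF assms(1,3)] pw integral_unique[OF I] by simp
qed

lemma functional_cont_dickson_zero:
  assumes "a > 0"
  shows "functional_cont a 0 (dickson a 0 n) = (if n = 0 then 1 else 0)"
proof -
  have I: "((\<lambda>\<theta>. complex_of_real (2 * sqrt a ^ n * cos (real n * \<theta>))) has_integral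
      complex_of_real (2 * sqrt a ^ n * (if n = 0 then pi else 0))) {0..pi}"
    using has_integral_cos_int_multiple[of "int n"]
    by (intro has_integral_of_real has_integral_mult_right) simp
  have "weight 0 = (\<lambda>_. 1)" by (simp add: weight_def fun_eq_iff)
  then show ?thesis
    unfolding functional_cont_eq[OF assms zero_neq_numeral]
    by (simp only: dickson_zero_cos[OF assms] of_real_1 mult_1_right integral_unique[OF I]) simp
qed

section \<open>The point masses and their compensation\<close>

text \<open>At x = (2-k)v the hypothesis makes v a root of v^2 - x v + a = 0, the characteristic
  equation of the recurrence. The initial values 2 - k and x already have ratio v, so the solution
  is purely geometric.\<close>

lemma dickson_Omega:
  assumes "v\<^sup>2 * complex_of_real (k - 1) = - complex_of_real a"
  shows "poly (dickson a k n) (complex_of_real (2 - k) * v) = complex_of_real (2 - k) * v ^ n"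
proof (induction n rule: induct_nat_012)
  case 0
  then show ?case by (simp add: dickson_0)
next
  case 1
  then show ?case by (simp add: dickson_1)
next
  case (ge2 n)
  have e: "complex_of_real (2 - k) * v * v - complex_of_real a = v * v"
    using assms by (simp add: power2_eq_square algebra_simps)
  let ?x = "complex_of_real (2 - k) * v"
  have "poly (dickson a k (Suc (Suc n))) ?x
     = ?x * poly (dickson a k (Suc n)) ?x - complex_of_real a * poly (dickson a k n) ?x"
    by (simp add: dickson_rec del: of_real_diff)
  also have "\<dots> = complex_of_real (2 - k) * v ^ n * (complex_of_real (2 - k) * v * v - complex_of_real a)"
    unfolding ge2.IH by (simp add: algebra_simps)
  finally show ?case unfolding e by (simp add: ac_simps)
qed

text \<open>Only v^2 is exported: the average of v^n and (-v)^n does not depend on the choice of the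
  square root.\<close>

lemma functional_disc_dickson:
  assumes "a > 0" "k \<noteq> 1" "k \<noteq> 2"
  obtains v where "v\<^sup>2 = - complex_of_real (a / (k - 1))"
    and "\<And>n. functional_disc a k (dickson a k n)
        = complex_of_real (k / (k - 1)) * ((v ^ n + (- v) ^ n) / 2)"
proof -
  \<comment> \<open>The minus sign turns the factor k - 2 of \<open>Omega\<close> into 2 - k, as
    \<open>dickson_Omega\<close> requires.\<close>
  define v where "v = - (complex_of_real (sqrt a) / csqrt (complex_of_real (k - 1)) * \<i>)"
  have k: "complex_of_real (k - 1) \<noteq> 0" "complex_of_real (2 - k) \<noteq> 0"
    using assms by (simp_all del: of_real_diff)
  have v2: "v\<^sup>2 = - complex_of_real (a / (k - 1))"
    unfolding v_def power2_minus power_mult_distrib power_divide power2_csqrt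
    using assms(1) by (simp flip: of_real_power)
  have v: "v\<^sup>2 * complex_of_real (k - 1) = - complex_of_real a"
    unfolding v2 using k by (simp del: of_real_diff)
  have "Omega a k = complex_of_real (2 - k) * v"
    unfolding Omega_def v_def by (simp add: field_simps diff_divide_distrib)
  then have poly_Omega: "poly (dickson a k n) (Omega a k) = complex_of_real (2 - k) * v ^ n"
      "poly (dickson a k n) (- Omega a k) = complex_of_real (2 - k) * (- v) ^ n" for n
    using dickson_Omega[OF v, of n] dickson_Omega[of "- v" k a n] v by (simp_all del: of_real_diff)
  have "functional_disc a k (dickson a k n)
        = complex_of_real (k / (k - 1)) * ((v ^ n + (- v) ^ n) / 2)" for n
  proof -
    have "functional_disc a k (dickson a k n)
       = complex_of_real k * (complex_of_real (2 - k) * v ^ n + complex_of_real (2 - k) * (- v) ^ n)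
         / complex_of_real (2 * (k - 1) * (2 - k))"
      unfolding functional_disc_def poly_Omega ..
    also have "\<dots> = complex_of_real k * (v ^ n + (- v) ^ n) * complex_of_real (2 - k)
         / (2 * complex_of_real (k - 1) * complex_of_real (2 - k))"
      by (simp only: distrib_left of_real_mult of_real_numeral mult.assoc mult.commute)
        (simp only: ac_simps)
    also have "\<dots> = complex_of_real k * (v ^ n + (- v) ^ n) / (2 * complex_of_real (k - 1))"
      using k by (simp del: of_real_diff)
    finally show ?thesis by simp
  qed
  with v2 show ?thesis by (rule that)
qed

lemma functional_sum_dickson_outer:
  assumes a: "a > 0" and k: "k < 0 \<or> 2 < k"
  shows "functional_cont a k (dickson a k n) + functional_disc a k (dickson a k n)
    = (if n = 0 then 1 else 0)"
proof -
  let ?q = "complex_of_real (a / (k - 1))"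
  let ?T = "\<lambda>n. functional_cont a k (dickson a k n) + functional_disc a k (dickson a k n)"
  have k': "k \<noteq> 0" "k \<noteq> 1" "k \<noteq> 2" "k - 1 \<noteq> 0" using k by auto
  obtain v where v: "v\<^sup>2 = - ?q"
    and d: "\<And>n. functional_disc a k (dickson a k n)
        = complex_of_real (k / (k - 1)) * ((v ^ n + (- v) ^ n) / 2)"
    using functional_disc_dickson[OF a k'(2,3)] by metis
  note c = functional_cont_dickson[OF a k'(1,3)]
  note m = dickson_moment_outer[OF k]
  have s: "sqrt a * (sqrt a * x) = a * x" for x using a by simp
  have T0: "?T 0 = 1"
  proof -
    have "2 / pi * sqrt a ^ 0 * dickson_moment k (int 0 + 1) = - (1 / (k - 1))"
    proof -
      have "2 / pi * (- pi / (2 * d)) = - (1 / d)" for d :: real by simp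
      then show ?thesis by (simp only: m(1) power_0 mult_1_right of_nat_0 add_0)
    qed
    then have "?T 0 = complex_of_real (- (1 / (k - 1)) + k / (k - 1))"
      unfolding c d by simp
    also have "- (1 / (k - 1)) + k / (k - 1) = 1"
      using diff_divide_distrib[of k 1 "k - 1"] divide_self[OF k'(4)] by linarith
    finally show ?thesis by simp
  qed
  have T1: "?T 1 = 0" unfolding c d by (simp add: m)
  have T2: "?T 2 = 0"
  proof -
    have "2 / pi * sqrt a ^ 2 * dickson_moment k (int 2 + 1) = k / (k - 1) * (a / (k - 1))"
    proof -
      have "2 / pi * a * (pi * k / (2 * d\<^sup>2)) = k / d * (a / d)" for d :: real
        by (simp add: power2_eq_square)
      moreover have "int 2 + 1 = (3 :: int)" "sqrt a ^ 2 = a" using a by simp_all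
      ultimately show ?thesis by (simp only: m(3))
    qed
    then have "functional_cont a k (dickson a k 2) = complex_of_real (k / (k - 1)) * ?q"
      unfolding c of_real_mult[symmetric] by (rule arg_cong)
    \<comment> \<open>For n = 2 the average is v^2 = -a/(k-1), so the point masses cancel the
      continuous part exactly.\<close>
    moreover have "functional_disc a k (dickson a k 2) = - (complex_of_real (k / (k - 1)) * ?q)"
      unfolding d power2_minus v by (simp del: of_real_divide)
    ultimately show ?thesis by simp
  qed
  \<comment> \<open>Both parts scale by -a/(k-1) when n grows by 2. For the moments this holds only
    from K_2 on, hence n >= 1 and the three separate values T 0, T 1, T 2.\<close>
  have step: "?T (Suc (Suc n)) = - ?q * ?T n" if "n \<ge> 1" for n
  proof -
    have "2 / pi * sqrt a ^ Suc (Suc n) * dickson_moment k (int (Suc (Suc n)) + 1)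
        = - (a / (k - 1)) * (2 / pi * sqrt a ^ n * dickson_moment k (int n + 1))"
    proof -
      have "int (Suc (Suc n)) + 1 = (int n + 1) + 2" by simp
      then show ?thesis
        using m(4)[of "int n + 1"] that by (simp add: s field_simps)
    qed
    then have C: "functional_cont a k (dickson a k (Suc (Suc n))) = - ?q * functional_cont a k (dickson a k n)"
      unfolding c by (metis of_real_minus of_real_mult)
    have "w ^ Suc (Suc n) = - ?q * w ^ n" if "w\<^sup>2 = - ?q" for w
      using that by (simp add: power2_eq_square flip: mult.assoc)
    then have "v ^ Suc (Suc n) = - ?q * v ^ n" "(- v) ^ Suc (Suc n) = - ?q * (- v) ^ n"
      using v by (metis, metis power2_minus)
    then have D: "functional_disc a k (dickson a k (Suc (Suc n))) = - ?q * functional_disc a k (dickson a k n)"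
      unfolding d by (simp only:) (simp only: distrib_left times_divide_eq_right ac_simps)
    show ?thesis unfolding C D by (simp only: distrib_left)
  qed
  have "?T n = 0 \<and> ?T (Suc n) = 0" if "n \<ge> 1" for n
    using that
  proof (induction n rule: nat_induct_at_least)
    case base
    then show ?case using T1 T2 by (simp add: numeral_2_eq_2)
  next
    case (Suc n)
    then show ?case using step[of n] by simp
  qed
  then show ?thesis using T0 by (cases "n = 0") auto
qed

theorem theorem27:
  fixes a k :: real and L :: "complex poly \<Rightarrow> complex"
  assumes "a > 0" and "k \<noteq> 2"
    and "is_dickson_functional a k L"
  shows "\<forall>r. L r = functional_cont a k r + chi k * functional_disc a k r"
proof
  fix r
  let ?R = "\<lambda>r. functional_cont a k r + chi k * functional_disc a k r"
  have lin: "Vector_Spaces.linear smult (*) L"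
    and orth: "\<And>n m. L (dickson a k n * dickson a k m)
        = (if n = m then complex_of_real (dickson_norm a k n) else 0)"
    using assms(3) by (auto simp: is_dickson_functional_def)
  have Ladd: "L (p + q) = L p + L q" and Lscale: "L (smult c p) = c * L p" for p q c
    using module_hom.add[OF module_hom_linearI[OF lin]] module_hom.scale[OF module_hom_linearI[OF lin]]
    by auto
  have k2: "complex_of_real (2 - k) \<noteq> 0" using assms(2) by (simp del: of_real_diff)
  have LD: "L (dickson a k n) = (if n = 0 then 1 else 0)" for n
  proof -
    \<comment> \<open>Orthogonality against the constant D_0 = 2 - k; since h_0 is also 2 - k, the
      factor cancels to 1.\<close>
    have "complex_of_real (2 - k) * L (dickson a k n) = L (dickson a k n * dickson a k 0)"
      by (simp add: dickson_0 Lscale del: of_real_diff)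
    also have "\<dots> = complex_of_real (2 - k) * (if n = 0 then 1 else 0)"
      unfolding orth by (simp add: dickson_norm_def)
    finally show ?thesis using k2 by simp
  qed
  have RD: "?R (dickson a k n) = (if n = 0 then 1 else 0)" for n
  proof -
    \<comment> \<open>k = 0 stands apart because \<open>den\<close> vanishes at the endpoints; k = 1
      lies in the middle case, where \<open>chi\<close> removes the discrete part.\<close>
    consider "k = 0" | "0 < k" "k < 2" | "k < 0 \<or> 2 < k" using assms(2) by linarith
    then show ?thesis
    proof cases
      case 1
      then show ?thesis using functional_cont_dickson_zero[OF assms(1)] by (simp add: chi_def)
    next
      case 2
      then show ?thesis
        using functional_cont_dickson[OF assms(1) _ assms(2)] dickson_moment_inner[of k "int n + 1"]
        by (simp add: chi_def)
    next
      case 3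
      then have "chi k = 1" by (auto simp: chi_def)
      then show ?thesis using functional_sum_dickson_outer[OF assms(1) 3] by simp
    qed
  qed
  have "L r - ?R r = 0"
  proof (rule linear_functional_eq_0[where M = "\<lambda>r. L r - ?R r", OF _ _ assms(2)])
    show "L (p + q) - ?R (p + q) = L p - ?R p + (L q - ?R q)" for p q
      unfolding Ladd functional_cont_add[OF assms(1,2)]
      by (simp add: functional_disc_def algebra_simps add_divide_distrib)
    show "L (smult c p) - ?R (smult c p) = c * (L p - ?R p)" for c p
      unfolding Lscale functional_cont_smult
      by (simp add: functional_disc_def algebra_simps add_divide_distrib)
    show "L (dickson a k n) - ?R (dickson a k n) = 0" for n
      unfolding LD RD by simp
  qed
  then show "L r = ?R r" by simp
qed

end
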